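(* For every $n\in\mathbb{N}$, let $s_n,c_n,e_n$ be the polynomials satisfying $s_n''+s_n=-x^n$, $c_n''+c_n=x^n$ and $e_n'+e_n=x^n$. Then $$c_n(x)=\frac{i^n}{2}\left[(-1)^n e_n(ix)+e_n(-ix)\right],\qquad c_n'(x)=\frac{i^{n+1}}{2}\left[(-1)^{n+1}e_n(ix)+e_n(-ix)\right],$$ $$s_n(x)=\frac{i^n}{2}\left[(-1)^{n+1}e_n(ix)-e_n(-ix)\right],\qquad s_n'(x)=\frac{i^{n+1}}{2}\left[(-1)^{n}e_n(ix)-e_n(-ix)\right].$$ Moreover, with $\hat{s}_{n}=-s_{n+1}'$ and $\hat{c}_{n}=c_{n+1}'$, one has $c_n(x)=-s_n(x)$ and $\hat{s}_n(x)=\hat{c}_n(x)$ for all $n\in\mathbb{N}$.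
   Context: $\mathbb{N}=\{0,1,2,\dots\}$, $i^2=-1$. These polynomials arise from $\int x^n\sin x\,dx=s_n(x)\cos x+\hat{s}_{n-1}(x)\sin x+\text{const}$, $\int x^n\cos x\,dx=c_n(x)\sin x+\hat{c}_{n-1}(x)\cos x+\text{const}$ and $\int x^ne^x\,dx=e_n(x)e^x+\text{const}$. In each of the defining differential equations the polynomial solution has degree $n$. A prime denotes differentiation with respect to $x$. *)

theory Defs
  imports Complex_Main "HOL-Computational_Algebra.Polynomial"
begin

text \<open>The definite descriptions below are justified by \<open>s_pol_ex1\<close>, \<open>c_pol_ex1\<close> and \<open>e_pol_ex1\<close>.\<close>

definition s_pol :: "nat \<Rightarrow> real poly" where
  "s_pol n = (THE p. pderiv (pderiv p) + p = - monom 1 n)"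

definition c_pol :: "nat \<Rightarrow> real poly" where
  "c_pol n = (THE p. pderiv (pderiv p) + p = monom 1 n)"

definition e_pol :: "nat \<Rightarrow> real poly" where
  "e_pol n = (THE p. pderiv p + p = monom 1 n)"

definition s_hat :: "nat \<Rightarrow> real poly" where
  "s_hat n = - pderiv (s_pol (Suc n))"

definition c_hat :: "nat \<Rightarrow> real poly" where
  "c_hat n = pderiv (c_pol (Suc n))"

definition cpoly :: "real poly \<Rightarrow> complex \<Rightarrow> complex" where
  "cpoly p z = poly (map_poly complex_of_real p) z"

lemma pderiv_plus_self_eq_0:
  fixes p :: "real poly"
  assumes "pderiv p + p = 0"
  shows "p = 0"
proof (rule ccontr)
  assume "p \<noteq> 0"
  have "coeff (pderiv p + p) (degree p) = lead_coeff p"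
    by (simp add: coeff_pderiv coeff_eq_0)
  with assms \<open>p \<noteq> 0\<close> show False by simp
qed

lemma pderiv2_plus_self_eq_0:
  fixes p :: "real poly"
  assumes "pderiv (pderiv p) + p = 0"
  shows "p = 0"
proof (rule ccontr)
  assume "p \<noteq> 0"
  have "coeff (pderiv (pderiv p) + p) (degree p) = lead_coeff p"
    by (simp add: coeff_pderiv coeff_eq_0)
  with assms \<open>p \<noteq> 0\<close> show False by simp
qed

lemma e_pol_ex1: "\<exists>!p :: real poly. pderiv p + p = monom 1 n"
proof (rule ex_ex1I)
  show "\<exists>p :: real poly. pderiv p + p = monom 1 n"
  proof (induction n)
    case 0
    show ?case by (rule exI[of _ "monom 1 0"]) (simp add: pderiv_monom)
  next
    case (Suc n)
    then obtain p :: "real poly" where p: "pderiv p + p = monom 1 n" by blast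
    let ?q = "monom 1 (Suc n) - smult (of_nat (Suc n)) p"
    have "pderiv ?q + ?q = monom 1 (Suc n) + smult (of_nat (Suc n)) (monom 1 n)
        - smult (of_nat (Suc n)) (pderiv p + p)"
      by (simp add: pderiv_diff pderiv_smult pderiv_monom smult_monom smult_add_right
          del: of_nat_Suc)
    then have "pderiv ?q + ?q = monom 1 (Suc n)" by (simp add: p)
    then show ?case by blast
  qed
next
  fix p q :: "real poly"
  assume "pderiv p + p = monom 1 n" "pderiv q + q = monom 1 n"
  moreover have "pderiv (p - q) + (p - q) = (pderiv p + p) - (pderiv q + q)"
    by (simp add: pderiv_diff)
  ultimately have "pderiv (p - q) + (p - q) = 0" by simp
  from pderiv_plus_self_eq_0[OF this] show "p = q" by simp
qed

lemma c_pol_ex1: "\<exists>!p :: real poly. pderiv (pderiv p) + p = monom 1 n"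
proof (rule ex_ex1I)
  show "\<exists>p :: real poly. pderiv (pderiv p) + p = monom 1 n"
  proof (induction n rule: induct_nat_012)
    case 0
    show ?case by (rule exI[of _ "monom 1 0"]) (simp add: pderiv_monom)
  next
    case 1
    show ?case by (rule exI[of _ "monom 1 (Suc 0)"]) (simp add: pderiv_monom)
  next
    case (ge2 n)
    then obtain p :: "real poly" where p: "pderiv (pderiv p) + p = monom 1 n" by blast
    define a :: real where "a = of_nat (Suc (Suc n)) * of_nat (Suc n)"
    let ?m = "monom (1 :: real) (Suc (Suc n))"
    let ?q = "?m - smult a p"
    have "pderiv (pderiv ?m) = smult a (monom 1 n)"
      by (simp add: pderiv_monom smult_monom a_def del: of_nat_Suc)
    then have "pderiv (pderiv ?q) + ?q = ?m + smult a (monom 1 n)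
        - smult a (pderiv (pderiv p) + p)"
      by (simp add: pderiv_diff pderiv_smult smult_add_right)
    then have "pderiv (pderiv ?q) + ?q = ?m" by (simp add: p)
    then show ?case by blast
  qed
next
  fix p q :: "real poly"
  assume "pderiv (pderiv p) + p = monom 1 n" "pderiv (pderiv q) + q = monom 1 n"
  moreover have "pderiv (pderiv (p - q)) + (p - q)
      = (pderiv (pderiv p) + p) - (pderiv (pderiv q) + q)"
    by (simp add: pderiv_diff)
  ultimately have "pderiv (pderiv (p - q)) + (p - q) = 0" by simp
  from pderiv2_plus_self_eq_0[OF this] show "p = q" by simp
qed

lemma s_pol_ex1: "\<exists>!p :: real poly. pderiv (pderiv p) + p = - monom 1 n"
proof (rule ex_ex1I)
  obtain p :: "real poly" where p: "pderiv (pderiv p) + p = monom 1 n"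
    using c_pol_ex1 by blast
  have "pderiv (pderiv (- p)) + (- p) = - (pderiv (pderiv p) + p)"
    by (simp add: pderiv_minus)
  then show "\<exists>p :: real poly. pderiv (pderiv p) + p = - monom 1 n"
    unfolding p by (rule exI)
next
  fix p q :: "real poly"
  assume "pderiv (pderiv p) + p = - monom 1 n" "pderiv (pderiv q) + q = - monom 1 n"
  moreover have "pderiv (pderiv (p - q)) + (p - q)
      = (pderiv (pderiv p) + p) - (pderiv (pderiv q) + q)"
    by (simp add: pderiv_diff)
  ultimately have "pderiv (pderiv (p - q)) + (p - q) = 0" by simp
  from pderiv2_plus_self_eq_0[OF this] show "p = q" by simp
qed

lemma s_pol_ode: "pderiv (pderiv (s_pol n)) + s_pol n = - monom 1 n"
  unfolding s_pol_def by (rule theI'[OF s_pol_ex1])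

lemma c_pol_ode: "pderiv (pderiv (c_pol n)) + c_pol n = monom 1 n"
  unfolding c_pol_def by (rule theI'[OF c_pol_ex1])

lemma e_pol_ode: "pderiv (e_pol n) + e_pol n = monom 1 n"
  unfolding e_pol_def by (rule theI'[OF e_pol_ex1])

end

theory Submission
  imports Defs
begin

text \<open>If $E' + E = x^n$, then $A = E(\mathrm{i}x)$ and $B = E(-\mathrm{i}x)$ satisfy
  $A' = \mathrm{i}((\mathrm{i}x)^n - A)$ and $B' = -\mathrm{i}((-\mathrm{i}x)^n - B)$. In the
  combination of \<open>A\<close> and \<open>B\<close> given for $c_n$ the powers of \<open>x\<close> cancel after one differentiation,
  and a second one shows that it solves $p'' + p = x^n$, whose polynomial solution is unique even
  over the complex numbers.\<close>

text \<open>The second derivative contributes nothing in degree \<open>degree p\<close>, so the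
  leading coefficient of \<open>p\<close> survives in the sum. The coefficient type is general
  because the fact is applied over the reals, to compare \<open>s_pol\<close> with
  \<open>c_pol\<close>, and over the complex numbers, to identify \<open>c_pol\<close>.\<close>

lemma pderiv2_plus_self_eq_0_iff:
  fixes p :: "'a :: {comm_semiring_1, semiring_no_zero_divisors} poly"
  shows "pderiv (pderiv p) + p = 0 \<longleftrightarrow> p = 0"
proof
  assume eq: "pderiv (pderiv p) + p = 0"
  have "coeff (pderiv (pderiv p) + p) (degree p) = lead_coeff p"
    by (simp add: coeff_pderiv coeff_eq_0)
  with eq show "p = 0" by simp
qed simp

lemma map_poly_of_real_pderiv:
  "map_poly of_real (pderiv p) = pderiv (map_poly of_real p)"
  by (rule poly_eqI) (simp add: coeff_map_poly coeff_pderiv)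

lemma map_poly_of_real_add:
  "map_poly of_real (p + q) = map_poly of_real p + map_poly of_real q"
  by (rule poly_eqI) (simp add: coeff_map_poly)

lemma cpoly_uminus: "cpoly (- p) x = - cpoly p x"
proof -
  have "map_poly complex_of_real (- p) = - map_poly of_real p"
    by (rule poly_eqI) (simp add: coeff_map_poly)
  then show ?thesis by (simp add: cpoly_def)
qed

lemma s_pol_eq_uminus_c_pol: "s_pol n = - c_pol n"
proof -
  have "pderiv (pderiv (s_pol n + c_pol n)) + (s_pol n + c_pol n) =
    (pderiv (pderiv (s_pol n)) + s_pol n) + (pderiv (pderiv (c_pol n)) + c_pol n)"
    by (simp add: pderiv_add)
  then have "pderiv (pderiv (s_pol n + c_pol n)) + (s_pol n + c_pol n) = 0"
    by (simp add: s_pol_ode c_pol_ode)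
  then show ?thesis
    by (simp add: pderiv2_plus_self_eq_0_iff eq_neg_iff_add_eq_0)
qed

text \<open>Chain rule, with \<open>pderiv E\<close> eliminated by the equation. It serves for
  \<open>a\<close> equal to i and to -i.\<close>

lemma pderiv_exp_ode_pcompose_linear:
  fixes E :: "'a :: idom poly"
  assumes "pderiv E + E = monom 1 n"
  shows "pderiv (pcompose E [:0, a:]) = smult a (monom (a ^ n) n - pcompose E [:0, a:])"
proof -
  have "pderiv E = monom 1 n - E"
    using assms by (simp add: eq_diff_eq)
  moreover have "pcompose (monom 1 n) [:0, a:] = monom (a ^ n) n"
    by (induction n) (simp_all add: monom_Suc pcompose_pCons monom_0 smult_monom mult_monom)
  ultimately show ?thesis
    by (simp add: pderiv_pcompose pcompose_diff pderiv_pCons)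
qed

text \<open>Identities of polynomials rather than of values, so that formal differentiation and
  uniqueness apply.\<close>

lemma c_pol_complex:
  fixes n :: nat
  defines "E \<equiv> map_poly complex_of_real (e_pol n)"
  defines "A \<equiv> pcompose E [:0, \<i>:]" and "B \<equiv> pcompose E [:0, - \<i>:]"
  shows "map_poly complex_of_real (c_pol n) = smult (\<i> ^ n / 2) (smult ((-1) ^ n) A + B)"
    and "map_poly complex_of_real (pderiv (c_pol n))
      = smult (\<i> ^ (n + 1) / 2) (smult ((-1) ^ (n + 1)) A + B)"
proof -
  define C where "C = smult (\<i> ^ n / 2) (smult ((-1) ^ n) A + B)"
  define D where "D = smult (\<i> ^ (n + 1) / 2) (smult ((-1) ^ (n + 1)) A + B)"
  define Q where "Q = map_poly complex_of_real (c_pol n)"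
  have E: "pderiv E + E = monom 1 n"
    unfolding E_def
    by (simp flip: map_poly_of_real_pderiv map_poly_of_real_add add: e_pol_ode map_poly_monom)
  have A': "pderiv A = smult \<i> (monom (\<i> ^ n) n - A)"
    unfolding A_def by (rule pderiv_exp_ode_pcompose_linear[OF E])
  have B': "pderiv B = smult (- \<i>) (monom ((- \<i>) ^ n) n - B)"
    unfolding B_def by (rule pderiv_exp_ode_pcompose_linear[OF E])
  have minus_i: "(- \<i>) ^ n = (-1) ^ n * \<i> ^ n"
    by (rule power_minus)
  have i_sq: "\<i> ^ n * \<i> ^ n = (-1) ^ n"
    by (simp flip: power_mult_distrib)
  have m1_sq: "(-1) ^ n * (-1) ^ n = (1 :: complex)"
    by (simp flip: power_mult_distrib)
  \<comment> \<open>The monomials from \<open>A'\<close> and \<open>B'\<close> carry the opposite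
    factors i (-1)^n i^n and -i (-1)^n i^n, so they cancel.\<close>
  have C': "pderiv C = D"
    by (rule poly_eqI)
      (simp add: C_def D_def pderiv_smult pderiv_add A' B' minus_i algebra_simps)
  have D': "pderiv D = monom 1 n - C"
  proof (rule poly_eqI)
    fix k
    define m a b where "m = (if n = k then 1 else 0 :: complex)"
      and "a = coeff A k" and "b = coeff B k"
    \<comment> \<open>In \<open>D\<close> the sign of \<open>A\<close> is flipped, so the two
      monomials now add up; their total factor i^n i^n (-1)^n equals ((-1)^n)^2 = 1.\<close>
    have "coeff (pderiv D) k
      = \<i> ^ n * \<i> / 2 * (- ((-1) ^ n) * (\<i> * (\<i> ^ n * m - a))
          + - \<i> * ((-1) ^ n * \<i> ^ n * m - b))"
      by (simp add: D_def pderiv_smult pderiv_add pderiv_diff A' B' minus_i m_def a_def b_def)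
    also have "\<dots> = (\<i> ^ n * \<i> ^ n) * (-1) ^ n * m - \<i> ^ n / 2 * ((-1) ^ n * a + b)"
      by (simp add: algebra_simps)
    also have "\<dots> = coeff (monom 1 n - C) k"
      by (simp add: i_sq m1_sq C_def m_def a_def b_def)
    finally show "coeff (pderiv D) k = coeff (monom 1 n - C) k" .
  qed
  have Q: "pderiv (pderiv Q) + Q = monom 1 n"
    unfolding Q_def
    by (simp flip: map_poly_of_real_pderiv map_poly_of_real_add add: c_pol_ode map_poly_monom)
  \<comment> \<open>\<open>C\<close> has non-real coefficients a priori, so uniqueness is needed
    over the complex numbers.\<close>
  have "pderiv (pderiv (Q - C)) + (Q - C) = (pderiv (pderiv Q) + Q) - monom 1 n"
    by (simp add: pderiv_diff C' D')
  then have "Q = C"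
    using pderiv2_plus_self_eq_0_iff[of "Q - C"] by (simp add: Q)
  then show "map_poly complex_of_real (c_pol n) = smult (\<i> ^ n / 2) (smult ((-1) ^ n) A + B)"
    by (simp add: Q_def C_def)
  from \<open>Q = C\<close> C' show "map_poly complex_of_real (pderiv (c_pol n))
      = smult (\<i> ^ (n + 1) / 2) (smult ((-1) ^ (n + 1)) A + B)"
    by (simp add: Q_def D_def map_poly_of_real_pderiv)
qed

theorem mainTheorem8:
  fixes n :: nat
  shows "(\<forall>x :: complex.
      cpoly (c_pol n) x
        = \<i> ^ n / 2 * ((-1) ^ n * cpoly (e_pol n) (\<i> * x) + cpoly (e_pol n) (- \<i> * x))
    \<and> cpoly (pderiv (c_pol n)) x
        = \<i> ^ (n + 1) / 2 * ((-1) ^ (n + 1) * cpoly (e_pol n) (\<i> * x) + cpoly (e_pol n) (- \<i> * x))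
    \<and> cpoly (s_pol n) x
        = \<i> ^ n / 2 * ((-1) ^ (n + 1) * cpoly (e_pol n) (\<i> * x) - cpoly (e_pol n) (- \<i> * x))
    \<and> cpoly (pderiv (s_pol n)) x
        = \<i> ^ (n + 1) / 2 * ((-1) ^ n * cpoly (e_pol n) (\<i> * x) - cpoly (e_pol n) (- \<i> * x)))
    \<and> c_pol n = - s_pol n
    \<and> s_hat n = c_hat n"
proof -
  have c: "cpoly (c_pol n) x
        = \<i> ^ n / 2 * ((-1) ^ n * cpoly (e_pol n) (\<i> * x) + cpoly (e_pol n) (- \<i> * x))"
    and c': "cpoly (pderiv (c_pol n)) x
        = \<i> ^ (n + 1) / 2 * ((-1) ^ (n + 1) * cpoly (e_pol n) (\<i> * x) + cpoly (e_pol n) (- \<i> * x))"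
    for x
    unfolding cpoly_def c_pol_complex by (simp_all add: poly_pcompose mult.commute[of x])
  have s: "cpoly (s_pol n) x
        = \<i> ^ n / 2 * ((-1) ^ (n + 1) * cpoly (e_pol n) (\<i> * x) - cpoly (e_pol n) (- \<i> * x))"
    and s': "cpoly (pderiv (s_pol n)) x
        = \<i> ^ (n + 1) / 2 * ((-1) ^ n * cpoly (e_pol n) (\<i> * x) - cpoly (e_pol n) (- \<i> * x))"
    for x
    unfolding s_pol_eq_uminus_c_pol pderiv_minus cpoly_uminus c c'
    by (simp_all add: algebra_simps)
  \<comment> \<open>The minus sign in \<open>s_hat\<close> cancels the one from
    \<open>s_pol_eq_uminus_c_pol\<close> at index \<open>Suc n\<close>.\<close>
  have "s_hat n = c_hat n"
    by (simp add: s_hat_def c_hat_def s_pol_eq_uminus_c_pol pderiv_minus)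
  with c c' s s' show ?thesis
    by (auto simp: s_pol_eq_uminus_c_pol)
qed

end
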